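(* Let $\mathcal{H}$ be a real Hilbert space, let $M\subset\mathcal{H}$ be a nonempty set, and let $(x^k)_{k\in\mathbb{N}}\subset\mathcal{H}$ be a sequence that is Fejér* monotone with respect to $M$. Then: (i) for every $\bar{x}\in \mathrm{cl}(\mathrm{conv}(M))$, the scalar sequence $\left(\|x^k-\bar{x}\|\right)_{k\in\mathbb{N}}$ converges; (ii) for every $\bar{x}_1,\bar{x}_2\in \mathrm{cl}(\mathrm{conv}(M))$, the scalar sequence $\left(\langle \bar{x}_1-\bar{x}_2, x^k\rangle\right)_{k\in\mathbb{N}}$ converges.
   Context: $\mathbb{N}$ denotes the set of nonnegative integers. Let $\mathcal{H}$ be a real Hilbert space with inner product $\langle\cdot,\cdot\rangle$ and norm $\|\cdot\|$. A sequence $(x^k)_{k\in\mathbb{N}}\subset\mathcal{H}$ is Fejér* monotone with respect to a nonempty set $M\subset\mathcal{H}$ if for every $x\in M$ there exists $N(x)\in\mathbb{N}$ such that $\|x^{k+1}-x\|\le\|x^k-x\|$ for all $k\ge N(x)$. $\mathrm{conv}(M)$ is the convex hull of $M$ and $\mathrm{cl}(\cdot)$ denotes the (norm) closure. *)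

theory Defs
  imports "HOL-Analysis.Analysis"
begin

definition Fejer_star_monotone :: "(nat \<Rightarrow> 'a::real_inner) \<Rightarrow> 'a set \<Rightarrow> bool" where
  "Fejer_star_monotone x M \<longleftrightarrow>
     (\<forall>y\<in>M. \<exists>N. \<forall>k\<ge>N. norm (x (Suc k) - y) \<le> norm (x k - y))"

end

theory Submission
  imports Defs
begin

text \<open>
  Call \<open>y\<close> an anchor of the sequence if \<open>norm (x k - y)\<close> converges. For an arbitrary sequence in a
  real inner product space the anchors form a closed convex set. Convexity comes from the identity
  of Stewart, which expresses the squared distance to a point of a segment through the squared
  distances to its ends, up to a term independent of \<open>k\<close>; closedness comes from the fact that the distance to \<open>y\<close>
  depends on \<open>y\<close> in a 1-Lipschitz way, uniformly in \<open>k\<close>.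

  Fejer* monotonicity makes each point of \<open>M\<close> an anchor, since the distances to it are eventually
  nonincreasing and bounded below. The set of anchors therefore contains the closed convex hull of
  \<open>M\<close>, which is the first assertion. The second holds for any two anchors, because polarization
  writes the inner product with their difference as a difference of two squared distances plus a
  term independent of \<open>k\<close>, up to a factor.
\<close>

definition anchors :: "(nat \<Rightarrow> 'a::real_normed_vector) \<Rightarrow> 'a set" where
  "anchors x = {y. convergent (\<lambda>k. norm (x k - y))}"

text \<open>Squared distances are the quantities that satisfy linear identities in an inner product
  space; taking square roots loses nothing because norms are nonnegative.\<close>

lemma anchors_iff_convergent_square:
  "y \<in> anchors x \<longleftrightarrow> convergent (\<lambda>k. (norm (x k - y))\<^sup>2)"
proof
  assume "y \<in> anchors x"
  then show "convergent (\<lambda>k. (norm (x k - y))\<^sup>2)"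
    unfolding anchors_def convergent_def by (auto intro: tendsto_power)
next
  assume "convergent (\<lambda>k. (norm (x k - y))\<^sup>2)"
  then obtain L where "(\<lambda>k. (norm (x k - y))\<^sup>2) \<longlonglongrightarrow> L"
    by (auto simp: convergent_def)
  from tendsto_real_sqrt[OF this] show "y \<in> anchors x"
    by (auto simp: anchors_def convergent_def)
qed

lemma stewart_identity:
  fixes a b z :: "'a::real_inner"
  assumes "u + v = 1"
  shows "(norm (z - (u *\<^sub>R a + v *\<^sub>R b)))\<^sup>2 =
    u * (norm (z - a))\<^sup>2 + v * (norm (z - b))\<^sup>2 - u * v * (norm (a - b))\<^sup>2"
proof -
  have u: "u = 1 - v" using assms by simp
  show ?thesis
    unfolding u power2_norm_eq_inner
    by (simp add: inner_simps inner_commute algebra_simps power2_eq_square)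
qed

lemma convex_anchors: "convex (anchors x)" for x :: "nat \<Rightarrow> 'a::real_inner"
proof (rule convexI)
  fix a b and u v :: real
  assume ab: "a \<in> anchors x" "b \<in> anchors x" and uv: "u + v = 1"
  from ab have "convergent (\<lambda>k. u * (norm (x k - a))\<^sup>2 + v * (norm (x k - b))\<^sup>2
      - u * v * (norm (a - b))\<^sup>2)"
    unfolding anchors_iff_convergent_square
    by (intro convergent_diff convergent_add convergent_mult convergent_const)
  then show "u *\<^sub>R a + v *\<^sub>R b \<in> anchors x"
    by (simp add: anchors_iff_convergent_square stewart_identity[OF uv])
qed

text \<open>An anchor near \<open>y\<close> has a Cauchy sequence of distances, and the distances to \<open>y\<close> stay
  uniformly close to it; so they are Cauchy too.\<close>

lemma closed_anchors: "closed (anchors x)"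
proof -
  have "y \<in> anchors x" if y: "y \<in> closure (anchors x)" for y
  proof -
    have "Cauchy (\<lambda>k. norm (x k - y))"
    proof (rule metric_CauchyI)
      fix e :: real assume "0 < e"
      then obtain z where z: "z \<in> anchors x" "dist z y < e / 3"
        using y unfolding closure_approachable by (meson divide_pos_pos zero_less_numeral)
      from z(1) have "Cauchy (\<lambda>k. norm (x k - z))"
        by (simp add: anchors_def Cauchy_convergent_iff)
      then obtain N where
        N: "dist (norm (x m - z)) (norm (x n - z)) < e / 3" if "m \<ge> N" "n \<ge> N" for m n
        using \<open>0 < e\<close> metric_CauchyD[of "\<lambda>k. norm (x k - z)" "e / 3"] by auto
      have near: "\<bar>norm (x k - y) - norm (x k - z)\<bar> < e / 3" for k
        using norm_triangle_ineq3[of "x k - y" "x k - z"] z(2) by (simp add: dist_norm)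
      have "dist (norm (x m - y)) (norm (x n - y)) < e" if "m \<ge> N" "n \<ge> N" for m n
        using near[of m] near[of n] N[OF that] unfolding dist_real_def by linarith
      then show "\<exists>N. \<forall>m\<ge>N. \<forall>n\<ge>N. dist (norm (x m - y)) (norm (x n - y)) < e"
        by blast
    qed
    then show ?thesis
      by (simp add: anchors_def Cauchy_convergent_iff)
  qed
  then show ?thesis
    by (metis closed_closure closure_subset subsetI subset_antisym)
qed

lemma Fejer_star_monotone_subset_anchors:
  assumes "Fejer_star_monotone x M"
  shows "M \<subseteq> anchors x"
proof
  fix y assume "y \<in> M"
  then obtain N where N: "norm (x (Suc k) - y) \<le> norm (x k - y)" if "k \<ge> N" for k
    using assms unfolding Fejer_star_monotone_def by blast
  have "decseq (\<lambda>k. norm (x (k + N) - y))"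
    by (intro decseq_SucI) (simp add: N)
  then obtain L where "(\<lambda>k. norm (x (k + N) - y)) \<longlonglongrightarrow> L"
    using decseq_convergent[of _ 0] by (metis norm_ge_zero)
  then have "(\<lambda>k. norm (x k - y)) \<longlonglongrightarrow> L"
    by (rule LIMSEQ_offset)
  then show "y \<in> anchors x"
    by (auto simp: anchors_def convergent_def)
qed

lemma convergent_inner_anchors:
  fixes x :: "nat \<Rightarrow> 'a::real_inner"
  assumes "a \<in> anchors x" "b \<in> anchors x"
  shows "convergent (\<lambda>k. inner (a - b) (x k))"
proof -
  have polarization: "inner (a - b) (x k) =
      ((norm (x k - b))\<^sup>2 - (norm (x k - a))\<^sup>2 + ((norm a)\<^sup>2 - (norm b)\<^sup>2)) * (1 / 2)" for k
    unfolding power2_norm_eq_inner by (simp add: inner_simps inner_commute algebra_simps)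
  show ?thesis
    using assms unfolding polarization anchors_iff_convergent_square
    by (intro convergent_mult convergent_add convergent_diff convergent_const)
qed

theorem proposition3p8:
  fixes M :: "'a::{real_inner, complete_space} set" and x :: "nat \<Rightarrow> 'a"
  assumes "M \<noteq> {}"
    and "Fejer_star_monotone x M"
  shows "(\<forall>xbar \<in> closure (convex hull M). convergent (\<lambda>k. norm (x k - xbar))) \<and>
         (\<forall>xbar1 \<in> closure (convex hull M). \<forall>xbar2 \<in> closure (convex hull M).
            convergent (\<lambda>k. inner (xbar1 - xbar2) (x k)))"
proof -
  have "closure (convex hull M) \<subseteq> anchors x"
    by (intro closure_minimal hull_minimal Fejer_star_monotone_subset_anchors[OF assms(2)]
        convex_anchors closed_anchors)
  then have anchor: "y \<in> anchors x" if "y \<in> closure (convex hull M)" for y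
    using that by blast
  show ?thesis
  proof (intro conjI ballI)
    fix y assume "y \<in> closure (convex hull M)"
    from anchor[OF this] show "convergent (\<lambda>k. norm (x k - y))"
      by (simp add: anchors_def)
  next
    fix a b assume "a \<in> closure (convex hull M)" "b \<in> closure (convex hull M)"
    then show "convergent (\<lambda>k. inner (a - b) (x k))"
      by (intro convergent_inner_anchors anchor)
  qed
qed

end
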